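(* If $G$ is a connected, claw-free, cubic graph, then $\frac{F_t(G)}{F(G)} \le 2$. Moreover, this bound is asymptotically best possible: for every real $\epsilon > 0$ there exists a connected, claw-free, cubic graph $G$ with $\frac{F_t(G)}{F(G)} > 2 - \epsilon$.
   Context: Graphs are finite and simple. A graph is claw-free if it contains no induced $K_{1,3}$. Forcing process: given $S \subseteq V(G)$ of initially colored vertices, at each step, if a colored vertex has exactly one non-colored neighbor, that neighbor becomes colored. $S$ is a forcing set if iterating this process colors all of $V(G)$; $F(G)$ is the minimum size of a forcing set. A total forcing set is a forcing set $S$ such that $G[S]$ has no isolated vertex; $F_t(G)$ is the minimum size of a total forcing set. *)

theory Defs
  imports Complex_Main "Graph_Theory.Graph_Theory"
begin

text \<open>
  A finite simple graph is a \<^locale>\<open>graph\<close>: a finite symmetric digraph without loops and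
  without parallel arcs. Each undirected edge is represented by its two opposite arcs, so the
  degree of a vertex is its out-degree.
\<close>

definition cubic :: "('a, 'b) pre_digraph \<Rightarrow> bool" where
  "cubic G \<longleftrightarrow> (\<forall>v \<in> verts G. out_degree G v = 3)"

definition claw_free :: "('a, 'b) pre_digraph \<Rightarrow> bool" where
  "claw_free G \<longleftrightarrow> \<not> (\<exists>H. induced_subgraph H G \<and> K\<^bsub>1,3\<^esub> H)"

text \<open>
  One step of the process colours one vertex \<open>v\<close>, forced by a coloured vertex \<open>u\<close>. Forces
  never disable one another (a vertex that can be forced stays so until it is coloured), so it
  makes no difference whether they are performed one at a time or simultaneously.
\<close>

definition force_step :: "('a, 'b) pre_digraph \<Rightarrow> 'a set \<Rightarrow> 'a set \<Rightarrow> bool" where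
  "force_step G A B \<longleftrightarrow>
     (\<exists>u \<in> A. \<exists>v. {w. u \<rightarrow>\<^bsub>G\<^esub> w} - A = {v} \<and> B = insert v A)"

definition forcing_set :: "('a, 'b) pre_digraph \<Rightarrow> 'a set \<Rightarrow> bool" where
  "forcing_set G S \<longleftrightarrow> S \<subseteq> verts G \<and> (force_step G)\<^sup>*\<^sup>* S (verts G)"

definition total_forcing_set :: "('a, 'b) pre_digraph \<Rightarrow> 'a set \<Rightarrow> bool" where
  "total_forcing_set G S \<longleftrightarrow>
     forcing_set G S \<and> (\<forall>u \<in> S. \<exists>v. u \<rightarrow>\<^bsub>G \<restriction> S\<^esub> v)"

definition forcing_number :: "('a, 'b) pre_digraph \<Rightarrow> nat" where
  "forcing_number G = (LEAST k. \<exists>S. forcing_set G S \<and> card S = k)"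

text \<open>Meaningful only for graphs without isolated vertices; the others have no total forcing set.\<close>

definition total_forcing_number :: "('a, 'b) pre_digraph \<Rightarrow> nat" where
  "total_forcing_number G = (LEAST k. \<exists>S. total_forcing_set G S \<and> card S = k)"

text \<open>
  For the graphs considered both minima range over nonempty sets, and the forcing
  number is positive, so the ratio never involves a division by zero.
\<close>

lemma forcing_set_verts: "forcing_set G (verts G)"
  by (simp add: forcing_set_def)

lemma (in graph) total_forcing_set_verts:
  assumes "cubic G"
  shows "total_forcing_set G (verts G)"
  unfolding total_forcing_set_def
proof (intro conjI ballI)
  show "forcing_set G (verts G)" by (rule forcing_set_verts)
next
  fix u assume u: "u \<in> verts G"
  then have "card (out_arcs G u) = 3" using assms by (simp add: cubic_def out_degree_def)
  then have "out_arcs G u \<noteq> {}" by auto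
  then obtain e where e: "e \<in> arcs G" "tail G e = u" unfolding out_arcs_def by blast
  then have "u \<rightarrow>\<^bsub>G \<restriction> verts G\<^esub> head G e"
    by (auto simp: arcs_ends_conv induce_subgraph_def)
  then show "\<exists>v. u \<rightarrow>\<^bsub>G \<restriction> verts G\<^esub> v" by blast
qed

lemma forcing_set_nonempty:
  assumes "forcing_set G S" "verts G \<noteq> {}"
  shows "S \<noteq> {}"
proof
  assume "S = {}"
  with assms have "(force_step G)\<^sup>*\<^sup>* {} (verts G)" by (simp add: forcing_set_def)
  then show False using assms(2) by (cases rule: converse_rtranclpE) (auto simp: force_step_def)
qed

lemma (in graph) forcing_number_pos:
  assumes "verts G \<noteq> {}"
  shows "forcing_number G > 0"
proof -
  have "\<exists>k S. forcing_set G S \<and> card S = k" using forcing_set_verts by blast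
  from LeastI_ex[OF this] obtain S where S: "forcing_set G S" "card S = forcing_number G"
    by (auto simp: forcing_number_def)
  then have "finite S" using finite_verts by (auto simp: forcing_set_def intro: finite_subset)
  then show ?thesis using S forcing_set_nonempty[OF S(1) assms] by (metis card_gt_0_iff)
qed

end

(*
  Enlarging a forcing set keeps it forcing, so adding to each vertex of a minimum forcing set one
  of its neighbours gives a total forcing set of at most twice the size.

  For the sharpness, arrange k diamonds (K_4 minus an edge) in a ring, joining the degree-2
  vertices of consecutive diamonds. The two middle vertices of a diamond are twins, so every forcing
  set contains one of them; as all its neighbours lie in the same diamond, a total forcing set meets
  each diamond at least twice and has at least 2k vertices. On the other hand, one middle vertex of
  each diamond and two more vertices of a single diamond are enough to force the ring one diamond
  after the other, so the forcing number is at most k + 2.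
*)
theory Submission
  imports Defs
begin

section \<open>Monotonicity of the forcing process\<close>

text \<open>Zero steps are allowed, so that a force can be replayed even when its target is already
  coloured.\<close>

lemma force_steps_insert:
  assumes "u \<in> A" "u \<rightarrow>\<^bsub>G\<^esub> v" "{w. u \<rightarrow>\<^bsub>G\<^esub> w} \<subseteq> insert v A"
  shows "(force_step G)\<^sup>*\<^sup>* A (insert v A)"
proof (cases "v \<in> A")
  case True
  then show ?thesis by (simp add: insert_absorb)
next
  case False
  with assms have "{w. u \<rightarrow>\<^bsub>G\<^esub> w} - A = {v}" by blast
  with assms(1) have "force_step G A (insert v A)" unfolding force_step_def by blast
  then show ?thesis by (rule r_into_rtranclp)
qed

text \<open>The forces leading to \<open>X\<close> are replayed from \<open>B\<close>: with more
  vertices coloured, each forcing vertex has no uncoloured neighbour besides its original target.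
  \<open>Y\<close> may exceed \<open>X\<close> by vertices of \<open>B\<close>.\<close>

lemma force_steps_mono:
  assumes "(force_step G)\<^sup>*\<^sup>* A X" "A \<subseteq> B"
  shows "\<exists>Y. X \<subseteq> Y \<and> (force_step G)\<^sup>*\<^sup>* B Y"
  using assms(1)
proof (induction rule: rtranclp_induct)
  case base
  then show ?case using assms(2) by blast
next
  case (step X X')
  then obtain Y where Y: "X \<subseteq> Y" "(force_step G)\<^sup>*\<^sup>* B Y" by blast
  from step.hyps(2) obtain u v where uv: "u \<in> X" "{w. u \<rightarrow>\<^bsub>G\<^esub> w} - X = {v}" "X' = insert v X"
    unfolding force_step_def by blast
  then have "(force_step G)\<^sup>*\<^sup>* Y (insert v Y)"
    using Y(1) by (intro force_steps_insert[of u]) blast+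
  with Y uv(3) show ?case by (meson insert_mono rtranclp_trans)
qed

lemma (in wf_digraph) force_steps_subset_verts:
  assumes "(force_step G)\<^sup>*\<^sup>* A X" "A \<subseteq> verts G"
  shows "X \<subseteq> verts G"
  using assms(1)
proof (induction rule: rtranclp_induct)
  case base
  then show ?case using assms(2) .
next
  case (step X X')
  then show ?case using adj_in_verts(2) unfolding force_step_def by blast
qed

text \<open>Replaying the forces from \<open>T\<close> colours at least \<open>verts G\<close>, and
  forces starting inside \<open>verts G\<close> never leave it.\<close>

lemma (in wf_digraph) forcing_set_superset:
  assumes "forcing_set G S" "S \<subseteq> T" "T \<subseteq> verts G"
  shows "forcing_set G T"
proof -
  from assms(1) have "(force_step G)\<^sup>*\<^sup>* S (verts G)" by (simp add: forcing_set_def)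
  from force_steps_mono[OF this assms(2)]
  obtain Y where Y: "verts G \<subseteq> Y" "(force_step G)\<^sup>*\<^sup>* T Y" by (elim exE conjE)
  have "Y = verts G" using force_steps_subset_verts[OF Y(2) assms(3)] Y(1) by (rule equalityI)
  then show ?thesis using Y(2) assms(3) by (simp add: forcing_set_def)
qed

section \<open>Total forcing number at most twice the forcing number\<close>

lemma adj_induce_subgraph:
  "u \<rightarrow>\<^bsub>G \<restriction> S\<^esub> v \<longleftrightarrow> u \<in> S \<and> v \<in> S \<and> u \<rightarrow>\<^bsub>G\<^esub> v"
  by (auto simp: arcs_ends_conv)

lemma obtain_minimum_forcing_set:
  obtains S where "forcing_set G S" "card S = forcing_number G"
proof -
  have "\<exists>k S. forcing_set G S \<and> card S = k" using forcing_set_verts by blast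
  from LeastI_ex[OF this] show ?thesis using that by (auto simp: forcing_number_def)
qed

lemma forcing_number_le: "forcing_set G S \<Longrightarrow> forcing_number G \<le> card S"
  unfolding forcing_number_def by (rule Least_le) blast

lemma total_forcing_number_le: "total_forcing_set G S \<Longrightarrow> total_forcing_number G \<le> card S"
  unfolding total_forcing_number_def by (rule Least_le) blast

lemma (in graph) total_forcing_number_le_double:
  assumes nbr: "\<And>u. u \<in> verts G \<Longrightarrow> \<exists>v. u \<rightarrow>\<^bsub>G\<^esub> v"
  shows "total_forcing_number G \<le> 2 * forcing_number G"
proof -
  obtain S where S: "forcing_set G S" "card S = forcing_number G"
    by (rule obtain_minimum_forcing_set)
  have sub: "S \<subseteq> verts G" using S(1) by (simp add: forcing_set_def)
  then have fin: "finite S" by (rule finite_subset) simp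
  obtain f where f: "u \<rightarrow>\<^bsub>G\<^esub> f u" if "u \<in> S" for u
    using nbr sub by (metis subsetD)
  have "S \<union> f ` S \<subseteq> verts G" using f sub adj_in_verts(2) by blast
  then have "forcing_set G (S \<union> f ` S)" using forcing_set_superset S(1) by blast
  moreover have "\<exists>v. u \<rightarrow>\<^bsub>G \<restriction> (S \<union> f ` S)\<^esub> v" if "u \<in> S \<union> f ` S" for u
    using that
  proof
    assume "u \<in> S"
    then show ?thesis using f by (auto simp: adj_induce_subgraph)
  next
    \<comment> \<open>A chosen neighbour \<open>f x\<close> is not isolated because \<open>x\<close>
      itself lies in the set.\<close>
    assume "u \<in> f ` S"
    then obtain x where "x \<in> S" "u = f x" by blast
    moreover from this have "u \<rightarrow>\<^bsub>G\<^esub> x" using f arcs_ends_symmetric[OF sym_arcs] by blast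
    ultimately show ?thesis by (auto simp: adj_induce_subgraph)
  qed
  ultimately have "total_forcing_set G (S \<union> f ` S)" by (simp add: total_forcing_set_def)
  then have "total_forcing_number G \<le> card (S \<union> f ` S)" by (rule total_forcing_number_le)
  also have "\<dots> \<le> card S + card (f ` S)" by (rule card_Un_le)
  also have "\<dots> \<le> 2 * card S" using card_image_le[OF fin, of f] by simp
  finally show ?thesis using S(2) by simp
qed

lemma cubic_imp_adj:
  assumes "cubic G" "u \<in> verts G"
  shows "\<exists>v. u \<rightarrow>\<^bsub>G\<^esub> v"
proof -
  have "card (out_arcs G u) = 3" using assms by (simp add: cubic_def out_degree_def)
  then have "out_arcs G u \<noteq> {}" by auto
  then obtain e where "e \<in> out_arcs G u" by blast
  then have "u \<rightarrow>\<^bsub>G\<^esub> head G e" by (auto simp: arcs_ends_conv)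
  then show ?thesis by blast
qed

section \<open>Twins in the forcing process, and a criterion for claw-freeness\<close>

text \<open>A coloured vertex adjacent to one uncoloured twin is adjacent to both, hence has two
  uncoloured neighbours and can force neither. With \<open>X\<close> the whole vertex set, every
  forcing set must contain one of the twins.\<close>

lemma force_steps_twins:
  assumes "(force_step G)\<^sup>*\<^sup>* S X" "x \<notin> S" "y \<notin> S" "x \<noteq> y"
    and twins: "\<And>u. u \<noteq> x \<Longrightarrow> u \<noteq> y \<Longrightarrow> u \<rightarrow>\<^bsub>G\<^esub> x \<longleftrightarrow> u \<rightarrow>\<^bsub>G\<^esub> y"
  shows "x \<notin> X \<and> y \<notin> X"
  using assms(1)
proof (induction rule: rtranclp_induct)
  case base
  then show ?case using assms by blast
next
  case (step X X')
  from step.hyps(2) obtain u v where uv: "u \<in> X" "{w. u \<rightarrow>\<^bsub>G\<^esub> w} - X = {v}" "X' = insert v X"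
    unfolding force_step_def by blast
  then have "u \<noteq> x" "u \<noteq> y" using step.IH by auto
  then have "x \<in> {w. u \<rightarrow>\<^bsub>G\<^esub> w} - X \<longleftrightarrow> y \<in> {w. u \<rightarrow>\<^bsub>G\<^esub> w} - X"
    using twins step.IH by simp
  then show ?case using uv step.IH assms(4) by auto
qed

text \<open>With at most three neighbours, the leaves of an induced claw centred at \<open>u\<close>
  would be the whole neighbourhood of \<open>u\<close>, which contains an edge \<open>x\<close>,
  \<open>y\<close>.\<close>

lemma claw_freeI:
  assumes "\<And>u. u \<in> verts G \<Longrightarrow> card {w. u \<rightarrow>\<^bsub>G\<^esub> w} \<le> 3"
    and fin: "\<And>u. u \<in> verts G \<Longrightarrow> finite {w. u \<rightarrow>\<^bsub>G\<^esub> w}"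
    and "\<And>u. u \<in> verts G \<Longrightarrow> \<exists>x y. u \<rightarrow>\<^bsub>G\<^esub> x \<and> u \<rightarrow>\<^bsub>G\<^esub> y \<and> x \<rightarrow>\<^bsub>G\<^esub> y"
  shows "claw_free G"
  unfolding claw_free_def
proof (rule notI, elim exE conjE)
  fix H assume ind: "induced_subgraph H G" and "K\<^bsub>1,3\<^esub> H"
  then obtain U V where UV: "verts H = U \<union> V" "U \<inter> V = {}" "card U = 1" "card V = 3"
    "arcs_ends H = U \<times> V \<union> V \<times> U"
    unfolding complete_bipartite_digraph_def by blast
  from \<open>card U = 1\<close> obtain u where U: "U = {u}" by (auto simp: card_1_singleton_iff)
  have sub: "verts H \<subseteq> verts G" and compat: "tail H = tail G" "head H = head G"
    and arcs: "arcs H = {e \<in> arcs G. tail G e \<in> verts H \<and> head G e \<in> verts H}"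
    using ind by (auto simp: induced_subgraph_def subgraph_def compatible_def)
  have adj: "x \<rightarrow>\<^bsub>H\<^esub> y \<longleftrightarrow> x \<in> verts H \<and> y \<in> verts H \<and> x \<rightarrow>\<^bsub>G\<^esub> y" for x y
    by (auto simp: arcs_ends_conv compat arcs)
  have u: "u \<in> verts G" using sub UV(1) U by blast
  have "V \<subseteq> {w. u \<rightarrow>\<^bsub>G\<^esub> w}" using adj UV(5) U by auto
  then have V: "V = {w. u \<rightarrow>\<^bsub>G\<^esub> w}"
    using assms(1)[OF u] UV(4) fin[OF u] by (metis card_seteq)
  obtain x y where "x \<in> V" "y \<in> V" "x \<rightarrow>\<^bsub>G\<^esub> y" using assms(3)[OF u] V by blast
  then have "x \<rightarrow>\<^bsub>H\<^esub> y" using adj UV(1) by blast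
  then show False using UV(2,5) \<open>x \<in> V\<close> \<open>y \<in> V\<close> by blast
qed

section \<open>The ring of diamonds as a connected claw-free cubic graph\<close>

text \<open>
  Vertices \<open>4 * i, \<dots>, 4 * i + 3\<close> form the \<open>i\<close>-th diamond, in which \<open>4 * i\<close> and \<open>4 * i + 3\<close> are the
  two non-adjacent vertices.
\<close>

definition necklace_nbrs :: "nat \<Rightarrow> nat \<Rightarrow> nat set" where
  "necklace_nbrs k u =
     (if u mod 4 = 0 then {u + 1, u + 2, if u = 0 then 4 * k - 1 else u - 1}
      else if u mod 4 = 1 then {u - 1, u + 1, u + 2}
      else if u mod 4 = 2 then {u - 2, u - 1, u + 1}
      else {u - 2, u - 1, if u = 4 * k - 1 then 0 else u + 1})"

text \<open>Arcs are the ordered pairs of adjacent vertices themselves, which rules out parallel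
  arcs.\<close>

definition necklace :: "nat \<Rightarrow> (nat, nat \<times> nat) pre_digraph" where
  "necklace k = \<lparr>verts = {..<4 * k}, arcs = {(u, v). u < 4 * k \<and> v \<in> necklace_nbrs k u},
     tail = fst, head = snd\<rparr>"

lemma verts_necklace [simp]: "verts (necklace k) = {..<4 * k}"
  by (simp add: necklace_def)

lemma arcs_ends_necklace: "arcs_ends (necklace k) = {(u, v). u < 4 * k \<and> v \<in> necklace_nbrs k u}"
  by (force simp: necklace_def arcs_ends_conv)

lemma adj_necklace [simp]: "u \<rightarrow>\<^bsub>necklace k\<^esub> v \<longleftrightarrow> u < 4 * k \<and> v \<in> necklace_nbrs k u"
  by (simp add: arcs_ends_necklace)

lemma diamond_cases:
  fixes u k :: nat
  assumes "u < 4 * k"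
  obtains i where "i < k" "u = 4 * i \<or> u = 4 * i + 1 \<or> u = 4 * i + 2 \<or> u = 4 * i + 3"
proof
  show "u div 4 < k" using assms by (simp add: less_mult_imp_div_less mult.commute)
  show "u = 4 * (u div 4) \<or> u = 4 * (u div 4) + 1 \<or> u = 4 * (u div 4) + 2 \<or> u = 4 * (u div 4) + 3"
    by presburger
qed

text \<open>The middle vertices are written with \<open>Suc\<close> because the simplifier turns
  \<open>4 * i + 1\<close> and \<open>4 * i + 2\<close> into that form. The conditionals close the
  ring between \<open>4 * k - 1\<close> and \<open>0\<close>.\<close>

lemma necklace_nbrs_simps:
  "necklace_nbrs k (4 * i) = {4 * i + 1, 4 * i + 2, if i = 0 then 4 * k - 1 else 4 * i - 1}"
  "necklace_nbrs k (Suc (4 * i)) = {4 * i, 4 * i + 2, 4 * i + 3}"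
  "necklace_nbrs k (Suc (Suc (4 * i))) = {4 * i, 4 * i + 1, 4 * i + 3}"
  "necklace_nbrs k (4 * i + 3) =
     {4 * i + 1, 4 * i + 2, if 4 * i + 3 = 4 * k - 1 then 0 else 4 * i + 4}"
proof -
  have "4 * i mod 4 = 0" "Suc (4 * i) mod 4 = 1" "Suc (Suc (4 * i)) mod 4 = 2" "(4 * i + 3) mod 4 = 3"
    by presburger+
  then show
    "necklace_nbrs k (4 * i) = {4 * i + 1, 4 * i + 2, if i = 0 then 4 * k - 1 else 4 * i - 1}"
    "necklace_nbrs k (Suc (4 * i)) = {4 * i, 4 * i + 2, 4 * i + 3}"
    "necklace_nbrs k (Suc (Suc (4 * i))) = {4 * i, 4 * i + 1, 4 * i + 3}"
    "necklace_nbrs k (4 * i + 3) =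
       {4 * i + 1, 4 * i + 2, if 4 * i + 3 = 4 * k - 1 then 0 else 4 * i + 4}"
    by (simp_all add: necklace_nbrs_def) auto
qed

lemma necklace_nbrs_less:
  assumes "u < 4 * k" "v \<in> necklace_nbrs k u"
  shows "v < 4 * k" "v \<noteq> u"
proof -
  obtain i where "i < k" and i: "u = 4 * i \<or> u = 4 * i + 1 \<or> u = 4 * i + 2 \<or> u = 4 * i + 3"
    using diamond_cases[OF assms(1)] .
  from i have "v < 4 * k \<and> v \<noteq> u"
    using \<open>i < k\<close> assms(2)
    by (elim disjE; simp add: necklace_nbrs_simps split: if_splits; linarith)
  then show "v < 4 * k" "v \<noteq> u" by simp_all
qed

text \<open>Edges inside a diamond are immediate; the care goes into ring edges, where the end of
  one diamond must point back to the end of the next, with a wrap-around at the last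
  diamond.\<close>

lemma necklace_nbrs_sym:
  assumes "u < 4 * k" "v \<in> necklace_nbrs k u"
  shows "u \<in> necklace_nbrs k v"
proof -
  obtain i where "i < k" and u: "u = 4 * i \<or> u = 4 * i + 1 \<or> u = 4 * i + 2 \<or> u = 4 * i + 3"
    using diamond_cases[OF assms(1)] .
  \<comment> \<open>\<open>l\<close> is the index of the last diamond; it turns
    \<open>4 * k - 1\<close> into \<open>4 * l + 3\<close>, avoiding truncated subtraction.\<close>
  obtain l where l: "k = Suc l" using \<open>i < k\<close> by (cases k) auto
  have last: "necklace_nbrs k (4 * l + 3) = {4 * l + 1, 4 * l + 2, 0}"
    using necklace_nbrs_simps(4)[of k l] l by simp
  from u show ?thesis
  proof (elim disjE)
    assume u: "u = 4 * i"
    show ?thesis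
    proof (cases i)
      case 0
      then have "v = 1 \<or> v = 2 \<or> v = 4 * l + 3"
        using assms(2) u l necklace_nbrs_simps(1)[of k 0] by auto
      then show ?thesis
        using u 0 last necklace_nbrs_simps(2,3)[of k 0] by (auto simp: numeral_2_eq_2)
    next
      case (Suc j)
      then have "v = 4 * i + 1 \<or> v = 4 * i + 2 \<or> v = 4 * j + 3"
        using assms(2) u necklace_nbrs_simps(1)[of k i] by auto
      \<comment> \<open>Diamond \<open>j\<close> is not the last one, so its end is joined to
        \<open>4 * i\<close> and not to \<open>0\<close>.\<close>
      moreover have "4 * j + 3 \<noteq> 4 * k - 1" using Suc \<open>i < k\<close> by simp
      ultimately show ?thesis
        using u Suc necklace_nbrs_simps(2,3)[of k i] necklace_nbrs_simps(4)[of k j] by auto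
    qed
  next
    assume u: "u = 4 * i + 3"
    show ?thesis
    proof (cases "i = l")
      case True
      then have "v = 4 * i + 1 \<or> v = 4 * i + 2 \<or> v = 0" using assms(2) u last by simp
      then show ?thesis
        using u True l necklace_nbrs_simps(2,3)[of k i] necklace_nbrs_simps(1)[of k 0] by auto
    next
      case False
      then have "4 * i + 3 \<noteq> 4 * k - 1" using l by simp
      then have "v = 4 * i + 1 \<or> v = 4 * i + 2 \<or> v = 4 * (i + 1)"
        using assms(2) u necklace_nbrs_simps(4)[of k i] by auto
      then show ?thesis
        using u necklace_nbrs_simps(2,3)[of k i] necklace_nbrs_simps(1)[of k "i + 1"] by auto
    qed
  qed (use assms(2) in \<open>auto simp: necklace_nbrs_simps\<close>)
qed

text \<open>The ring edge at the end of a diamond never coincides with an edge to a middle vertex,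
  even for \<open>k = 1\<close>, where it joins \<open>0\<close> to \<open>3\<close> and the graph
  is K_4.\<close>

lemma card_necklace_nbrs:
  assumes "u < 4 * k"
  shows "card (necklace_nbrs k u) = 3"
proof -
  obtain i where "i < k" "u = 4 * i \<or> u = 4 * i + 1 \<or> u = 4 * i + 2 \<or> u = 4 * i + 3"
    using diamond_cases[OF assms] .
  then show ?thesis
    by (elim disjE) (auto simp: necklace_nbrs_simps card_insert_if)
qed

lemma graph_necklace: "graph (necklace k)"
proof -
  have "arcs (necklace k) \<subseteq> {..<4 * k} \<times> {..<4 * k}"
    using necklace_nbrs_less(1) by (auto simp: necklace_def)
  then have "finite (arcs (necklace k))" by (rule finite_subset) simp
  moreover have "symmetric (necklace k)"
    unfolding symmetric_def arcs_ends_necklace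
    by (rule symI) (blast intro: necklace_nbrs_sym necklace_nbrs_less(1))
  ultimately show ?thesis
    by unfold_locales (auto simp: necklace_def arc_to_ends_def dest: necklace_nbrs_less)
qed

lemma cubic_necklace: "cubic (necklace k)"
  unfolding cubic_def
proof
  fix u assume "u \<in> verts (necklace k)"
  then have u: "u < 4 * k" by simp
  then have "out_arcs (necklace k) u = Pair u ` necklace_nbrs k u"
    by (auto simp: out_arcs_def necklace_def)
  then show "out_degree (necklace k) u = 3"
    using card_necklace_nbrs[OF u] by (simp add: out_degree_def card_image inj_on_def)
qed

lemma claw_free_necklace: "claw_free (necklace k)"
proof (rule claw_freeI)
  fix u assume "u \<in> verts (necklace k)"
  then have u: "u < 4 * k" by simp
  then have eq: "{w. u \<rightarrow>\<^bsub>necklace k\<^esub> w} = necklace_nbrs k u" by simp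
  show "card {w. u \<rightarrow>\<^bsub>necklace k\<^esub> w} \<le> 3" using eq card_necklace_nbrs[OF u] by simp
  show "finite {w. u \<rightarrow>\<^bsub>necklace k\<^esub> w}" unfolding eq by (simp add: necklace_nbrs_def)
  obtain i where i: "i < k" "u = 4 * i \<or> u = 4 * i + 1 \<or> u = 4 * i + 2 \<or> u = 4 * i + 3"
    using diamond_cases[OF u] .
  \<comment> \<open>Every vertex lies in a triangle of its diamond: an end with both middle
    vertices, a middle vertex with the other one and \<open>4 * i\<close>.\<close>
  let ?x = "if u = 4 * i + 1 then 4 * i else 4 * i + 1"
  let ?y = "if u = 4 * i + 2 then 4 * i else 4 * i + 2"
  have "u \<rightarrow>\<^bsub>necklace k\<^esub> ?x \<and> u \<rightarrow>\<^bsub>necklace k\<^esub> ?y \<and> ?x \<rightarrow>\<^bsub>necklace k\<^esub> ?y"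
    using i by (elim disjE) (simp_all add: necklace_nbrs_simps)
  then show "\<exists>x y. u \<rightarrow>\<^bsub>necklace k\<^esub> x \<and> u \<rightarrow>\<^bsub>necklace k\<^esub> y \<and> x \<rightarrow>\<^bsub>necklace k\<^esub> y" by blast
qed

text \<open>Consecutive numbers are adjacent, so the numbering is a Hamiltonian path starting at
  \<open>0\<close>.\<close>

lemma connected_necklace:
  assumes "k > 0"
  shows "Digraph_Component.connected (necklace k)"
proof -
  interpret graph "necklace k" by (rule graph_necklace)
  have reach: "0 \<rightarrow>\<^sup>*\<^bsub>necklace k\<^esub> u" if "u < 4 * k" for u
    using that
  proof (induction u rule: less_induct)
    case (less u)
    show ?case
    proof (cases "u = 0")
      case True
      then show ?thesis using assms by simp
    next
      case False
      obtain i where i: "i < k" "u = 4 * i \<or> u = 4 * i + 1 \<or> u = 4 * i + 2 \<or> u = 4 * i + 3"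
        using diamond_cases[OF less.prems] .
      have "u - 1 \<in> necklace_nbrs k u"
        using i False by (elim disjE) (simp_all add: necklace_nbrs_simps)
      then have "(u - 1) \<rightarrow>\<^bsub>necklace k\<^esub> u" 
        using necklace_nbrs_sym[OF less.prems] less.prems by simp
      moreover have "0 \<rightarrow>\<^sup>*\<^bsub>necklace k\<^esub> (u - 1)" using less False by auto
      ultimately show ?thesis by (rule reachable_adj_trans[rotated])
    qed
  qed
  have "u \<rightarrow>\<^sup>*\<^bsub>necklace k\<^esub> v" if "u < 4 * k" "v < 4 * k" for u v
    using symmetric_reachable[OF sym_arcs reach[OF that(1)]] reach[OF that(2)]
    by (rule reachable_trans)
  then show ?thesis
    unfolding Digraph_Component.connected_def
    using assms reachable_mk_symmetric_eq[OF sym_arcs]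
    by (intro strongly_connectedI) (auto simp: mk_symmetric_def lessThan_empty_iff)
qed

section \<open>Forcing and total forcing numbers of the ring\<close>

lemma forcing_number_necklace_le:
  assumes "k > 0"
  shows "forcing_number (necklace k) \<le> k + 2"
proof -
  let ?G = "necklace k"
  \<comment> \<open>One middle vertex per diamond; the extra vertices \<open>0\<close> and
    \<open>2\<close> make the first diamond complete but for its end \<open>3\<close>.\<close>
  define S where "S = insert 0 (insert 2 ((\<lambda>i. 4 * i + 1) ` {..<k}))"
  \<comment> \<open>The stage at which diamonds up to \<open>i\<close> are coloured, except possibly
    the end \<open>4 * i + 3\<close>; \<open>4 * k - 1\<close> is there because \<open>0\<close>
    forces it backwards around the ring at the very start.\<close>
  define W where "W i = insert (4 * k - 1) (S \<union> {..<4 * i + 3})" for i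
  have S1: "4 * i + 1 \<in> S" if "i < k" for i using that by (auto simp: S_def)
  have steps: "(force_step ?G)\<^sup>*\<^sup>* S (W i)" if "i < k" for i
    using that
  proof (induction i)
    case 0
    have "1 \<in> S" using S1[of 0] assms by simp
    moreover have "0 \<in> S" "2 \<in> S" by (auto simp: S_def)
    moreover from \<open>2 \<in> S\<close> have "Suc (Suc 0) \<in> S" by (simp add: numeral_2_eq_2)
    ultimately have "(force_step ?G)\<^sup>*\<^sup>* S (insert (4 * k - 1) S)"
      using assms necklace_nbrs_simps(1)[of k 0]
      by (intro force_steps_insert[of 0]) auto
    moreover have "{..<3} \<subseteq> S" using \<open>0 \<in> S\<close> \<open>1 \<in> S\<close> \<open>2 \<in> S\<close>
      by (auto simp: less_Suc_eq numeral_eq_Suc)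
    then have "W 0 = insert (4 * k - 1) S" by (auto simp: W_def)
    ultimately show ?case by simp
  next
    case (Suc i)
    \<comment> \<open>Three forces pass to the next diamond: \<open>4 * i + 1\<close> colours the
      end \<open>4 * i + 3\<close>, which colours \<open>4 * i + 4\<close>, which colours
      \<open>4 * i + 6\<close>, since \<open>4 * i + 5\<close> is already in
      \<open>S\<close>.\<close>
    let ?W1 = "insert (4 * i + 3) (W i)"
    let ?W2 = "insert (4 * i + 4) ?W1"
    let ?W3 = "insert (4 * i + 6) ?W2"
    have nbrs1: "necklace_nbrs k (4 * i + 1) = {4 * i, 4 * i + 2, 4 * i + 3}"
      using necklace_nbrs_simps(2)[of k i] by simp
    have "4 * i + 3 \<noteq> 4 * k - 1" using Suc.prems by linarith
    then have nbrs2: "necklace_nbrs k (4 * i + 3) = {4 * i + 1, 4 * i + 2, 4 * i + 4}"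
      using necklace_nbrs_simps(4)[of k i] by simp
    have "4 * i + 4 = 4 * (i + 1)" by simp
    then have nbrs3: "necklace_nbrs k (4 * i + 4) = {4 * i + 5, 4 * i + 6, 4 * i + 3}"
      by (simp only: necklace_nbrs_simps(1)) auto
    have "4 * (i + 1) + 1 \<in> S" by (rule S1) (use Suc.prems in simp)
    moreover have "4 * (i + 1) + 1 = 4 * i + 5" by simp
    ultimately have "4 * i + 5 \<in> W i" unfolding W_def by (metis UnI1 insertI2)
    have "(force_step ?G)\<^sup>*\<^sup>* S (W i)" using Suc by simp
    moreover have "(force_step ?G)\<^sup>*\<^sup>* (W i) ?W1"
      using Suc.prems nbrs1 by (intro force_steps_insert[of "4 * i + 1"]) (auto simp: W_def)
    moreover have "(force_step ?G)\<^sup>*\<^sup>* ?W1 ?W2"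
      using Suc.prems nbrs2 by (intro force_steps_insert[of "4 * i + 3"]) (auto simp: W_def)
    moreover have "(force_step ?G)\<^sup>*\<^sup>* ?W2 ?W3"
      using Suc.prems nbrs3 \<open>4 * i + 5 \<in> W i\<close>
      by (intro force_steps_insert[of "4 * i + 4"]) auto
    moreover have "?W3 = W (Suc i)"
    proof -
      have "{..<4 * Suc i + 3} =
          {..<4 * i + 3} \<union> {4 * i + 3, 4 * i + 4, 4 * i + 5, 4 * i + 6}" by auto
      then show ?thesis using \<open>4 * i + 5 \<in> W i\<close> by (auto simp: W_def)
    qed
    ultimately show ?case by (metis rtranclp_trans)
  qed
  have sub: "S \<subseteq> verts ?G" using assms by (auto simp: S_def)
  \<comment> \<open>The end of the last diamond is \<open>4 * k - 1\<close>, so nothing is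
    missing.\<close>
  have "W (k - 1) = verts ?G"
  proof -
    have "{..<4 * k} = insert (4 * k - 1) {..<4 * (k - 1) + 3}" using assms by auto
    then show ?thesis using sub by (auto simp: W_def)
  qed
  then have "forcing_set ?G S" using steps[of "k - 1"] assms sub by (simp add: forcing_set_def)
  then have "forcing_number ?G \<le> card S" by (rule forcing_number_le)
  also have "\<dots> \<le> k + 2"
  proof -
    have "card ((\<lambda>i. 4 * i + 1) ` {..<k}) \<le> k" by (metis card_image_le card_lessThan finite_lessThan)
    then show ?thesis by (simp add: S_def card_insert_if)
  qed
  finally show ?thesis .
qed

lemma total_forcing_number_necklace_ge: "2 * k \<le> total_forcing_number (necklace k)"
proof -
  let ?G = "necklace k"
  interpret graph ?G by (rule graph_necklace)
  have "\<exists>l S. total_forcing_set ?G S \<and> card S = l"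
    using total_forcing_set_verts[OF cubic_necklace] by blast
  from LeastI_ex[OF this] obtain S
    where S: "total_forcing_set ?G S" "card S = total_forcing_number ?G"
    by (auto simp: total_forcing_number_def)
  then have force: "(force_step ?G)\<^sup>*\<^sup>* S (verts ?G)" and "S \<subseteq> verts ?G"
    by (auto simp: total_forcing_set_def forcing_set_def)
  then have fin: "finite S" by (auto intro: finite_subset)
  define B where "B i = S \<inter> {4 * i..<4 * i + 4}" for i
  have B: "2 \<le> card (B i)" if "i < k" for i
  proof -
    let ?x = "4 * i + 1" and ?y = "4 * i + 2"
    have "u \<rightarrow>\<^bsub>?G\<^esub> ?x \<longleftrightarrow> u \<rightarrow>\<^bsub>?G\<^esub> ?y" if "u \<noteq> ?x" "u \<noteq> ?y" for u
    proof -
      \<comment> \<open>Reversing adjacency gives access to the explicit neighbourhoods of the two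
        middle vertices, which outside the pair are both \<open>{4 * i, 4 * i + 3}\<close>.\<close>
      have adj_sym: "u \<rightarrow>\<^bsub>?G\<^esub> w \<longleftrightarrow> w \<rightarrow>\<^bsub>?G\<^esub> u" for w
        using arcs_ends_symmetric[OF sym_arcs] by blast
      show ?thesis
        unfolding adj_sym[of ?x] adj_sym[of ?y] using that \<open>i < k\<close>
        by (simp add: necklace_nbrs_simps)
    qed
    then have "?x \<in> S \<or> ?y \<in> S"
      using force_steps_twins[OF force, of ?x ?y] \<open>i < k\<close> by auto
    then obtain x where x: "x \<in> S" "x = ?x \<or> x = ?y" by blast
    then obtain y where "y \<in> S" "x \<rightarrow>\<^bsub>?G\<^esub> y"
      using S(1) unfolding total_forcing_set_def adj_induce_subgraph by blast
    \<comment> \<open>All neighbours of a middle vertex lie in its own diamond, so \<open>y\<close>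
      is a second element of \<open>B i\<close>.\<close>
    then have "{x, y} \<subseteq> B i" "x \<noteq> y"
      using x by (auto simp: necklace_nbrs_simps B_def)
    then show ?thesis
      using card_mono[of "B i" "{x, y}"] fin by (simp add: B_def)
  qed
  have "2 * k = (\<Sum>i<k. 2)" by simp
  also have "\<dots> \<le> (\<Sum>i<k. card (B i))" using B by (intro sum_mono) simp
  also have "\<dots> = card (\<Union>i<k. B i)"
    using fin by (intro card_UN_disjoint[symmetric]) (auto simp: B_def)
  also have "\<dots> \<le> card S" using fin by (intro card_mono) (auto simp: B_def)
  finally show ?thesis using S(2) by simp
qed

section \<open>The ratio bound and its sharpness\<close>

theorem theorem4:
  shows "(\<forall>G :: ('a, 'b) pre_digraph.
            graph G \<and> Digraph_Component.connected G \<and> claw_free G \<and> cubic G \<longrightarrow>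
            real (total_forcing_number G) / real (forcing_number G) \<le> 2)
       \<and> (\<forall>\<epsilon> :: real. \<epsilon> > 0 \<longrightarrow>
            (\<exists>G :: (nat, nat \<times> nat) pre_digraph.
               graph G \<and> Digraph_Component.connected G \<and> claw_free G \<and> cubic G \<and>
               real (total_forcing_number G) / real (forcing_number G) > 2 - \<epsilon>))"
proof (intro conjI allI impI)
  fix G :: "('a, 'b) pre_digraph"
  assume G: "graph G \<and> Digraph_Component.connected G \<and> claw_free G \<and> cubic G"
  then interpret graph G by (elim conjE)
  have "total_forcing_number G \<le> 2 * forcing_number G"
    by (rule total_forcing_number_le_double) (rule cubic_imp_adj, use G in blast)
  then have "real (total_forcing_number G) \<le> 2 * real (forcing_number G)" by linarith
  \<comment> \<open>Were the denominator zero, the quotient would be \<open>0\<close> by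
    convention.\<close>
  then show "real (total_forcing_number G) / real (forcing_number G) \<le> 2"
    by (cases "forcing_number G = 0") (simp_all add: divide_le_eq)
next
  fix \<epsilon> :: real assume "\<epsilon> > 0"
  \<comment> \<open>The ratio is at least \<open>2 * k / (k + 2)\<close>, which falls short of 2 by
    \<open>4 / (k + 2)\<close>; this is below \<epsilon> once
    \<open>k > 4 / \<epsilon>\<close>.\<close>
  obtain k :: nat where k: "4 / \<epsilon> < real k" using reals_Archimedean2 by blast
  moreover have "0 < 4 / \<epsilon>" using \<open>\<epsilon> > 0\<close> by simp
  ultimately have "k > 0" by linarith
  let ?G = "necklace k"
  have "verts ?G \<noteq> {}" using \<open>k > 0\<close> by (simp add: lessThan_empty_iff)
  then have pos: "real (forcing_number ?G) > 0"
    using graph.forcing_number_pos[OF graph_necklace] by simp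
  have "4 < \<epsilon> * real k" using k \<open>\<epsilon> > 0\<close> by (simp add: field_simps)
  then have "2 - \<epsilon> < 2 * real k / (real k + 2)"
    using \<open>\<epsilon> > 0\<close> by (simp add: field_simps)
  also have "\<dots> \<le> 2 * real k / real (forcing_number ?G)"
    using pos forcing_number_necklace_le[OF \<open>k > 0\<close>] by (intro divide_left_mono) auto
  also have "\<dots> \<le> real (total_forcing_number ?G) / real (forcing_number ?G)"
    using pos total_forcing_number_necklace_ge[of k] by (intro divide_right_mono) auto
  finally show "\<exists>G :: (nat, nat \<times> nat) pre_digraph.
      graph G \<and> Digraph_Component.connected G \<and> claw_free G \<and> cubic G \<and>
      real (total_forcing_number G) / real (forcing_number G) > 2 - \<epsilon>"
    using graph_necklace connected_necklace[OF \<open>k > 0\<close>] claw_free_necklace cubic_necklace by blast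
qed

end
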